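(* The eigenvalue problem $$\frac{k_0}{Y'(x)^2}Y(x)\,u_n''(x)+\frac{1}{Y'(x)^3}\Big\{\big[Y(x)+k_0(1-\alpha)\big]Y'(x)^2-3k_0Y(x)Y''(x)\Big\}u_n'(x)$$ $$-\frac{1}{Y'(x)^4}\Big\{k_0Y(x)\big(Y'(x)Y'''(x)-3Y''(x)^2\big)+\big[k_0(1-\alpha)+Y(x)\big]Y'(x)^2Y''(x)-(1-\alpha)Y'(x)^4\Big\}u_n(x)=(n+1)u_n(x),$$ with the boundary condition $$\left\{\frac{1}{Y'(x)^3}\Big[Y(x)Y'(x)u'(x)-\big(\alpha Y'(x)^2+Y(x)Y''(x)\big)u(x)\Big]\right\}\Big|_{x=0}=0,$$ is solved by the monomials $$u_n(x)=\hat M^nu_0(x),\qquad u_0(x)=Y'(x)\,Y(x)^\alpha,\qquad \hat M=Y'(x)\hat D_x^{-1}+k_0 .$$ Explicitly the solutions are $$u_n(x)=Y'(x)Y(x)^\alpha\sum_{j=0}^n\frac{1}{j!}\binom{n+\alpha}{n-j}Y(x)^j k_0^{\,n-j}=Y'(x)Y(x)^\alpha L_n^{(\alpha)}\!\left(-\frac{Y(x)}{k_0}\right),\qquad \alpha>-1,$$ where $L_n^{(\alpha)}(z)$ is a generalized Laguerre polynomial. The function $Y(x)$ and the constants $k_0,\alpha$ satisfy $$\lim_{x\to\infty}\frac{Y(x)}{k_0}=-\infty,\qquad \alpha>-1 .$$ The orthogonality relation is $$\int_0^\infty\frac{Y(x)^{-\alpha}}{|Y'(x)|}\,e^{\fr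ac{1}{k_0}Y(x)}\,u_n(x)\,u_m(x)\,dx=(-k_0)^\alpha\,\delta_{m,n}.$$
   Context: $n,m\ge0$ are integers, $\hat D_x^{-1}u(x)=\int_0^xu(\xi)\,d\xi$, and primes denote derivatives with respect to $x$. $Y(x)$ is a sufficiently smooth function with $Y(0)=0$, otherwise arbitrary apart from the condition at infinity stated in the claim; $k_0$ and $\alpha$ are constants. The generalized Laguerre polynomials are $L_n^{(\alpha)}(z)=\sum_{j=0}^n\frac{(-1)^j}{j!}\binom{n+\alpha}{n-j}z^j$, and $\delta_{m,n}$ is the Kronecker delta.
   Formalization: The forms of u_n agree only up to constants: M^n u_0 is the sum form over binom(n+α,n), the sum form is k_0^n times the Laguerre form; the orthogonality constant gains |k_0|k_0^{2n}Γ(α+1)/binom(n+α,n), or u_n is normalized. Y' is nonzero for x>0; the boundary value is a limit. *)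

theory Defs
  imports "HOL-Analysis.Analysis"
begin

text \<open>
  Everything lives on the half-line \<open>x > 0\<close>. Functions \<open>u\<close> are complex-valued because \<open>Y\<close> is negative
  there when \<open>k0 > 0\<close>; non-integer powers of \<open>Y x\<close> and \<open>- k0\<close> are principal values, which are the
  usual real powers when \<open>k0 < 0\<close> (and hence \<open>Y > 0\<close>).
\<close>

definition laguerre :: "real \<Rightarrow> nat \<Rightarrow> real \<Rightarrow> real" where
  "laguerre \<alpha> n z = (\<Sum>j\<le>n. (-1) ^ j / fact j * ((real n + \<alpha>) gchoose (n - j)) * z ^ j)"

definition Dinv :: "(real \<Rightarrow> complex) \<Rightarrow> real \<Rightarrow> complex" where
  "Dinv u x = integral {0..x} u"

definition Mop :: "(real \<Rightarrow> real) \<Rightarrow> real \<Rightarrow> (real \<Rightarrow> complex) \<Rightarrow> real \<Rightarrow> complex" where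
  "Mop Y k0 u x = of_real (deriv Y x) * Dinv u x + of_real k0 * u x"

definition u0 :: "(real \<Rightarrow> real) \<Rightarrow> real \<Rightarrow> real \<Rightarrow> complex" where
  "u0 Y \<alpha> x = of_real (deriv Y x) * of_real (Y x) powr of_real \<alpha>"

definition monomial :: "(real \<Rightarrow> real) \<Rightarrow> real \<Rightarrow> real \<Rightarrow> nat \<Rightarrow> real \<Rightarrow> complex" where
  "monomial Y k0 \<alpha> n = (Mop Y k0 ^^ n) (u0 Y \<alpha>)"

definition sum_form :: "(real \<Rightarrow> real) \<Rightarrow> real \<Rightarrow> real \<Rightarrow> nat \<Rightarrow> real \<Rightarrow> complex" where
  "sum_form Y k0 \<alpha> n x =
     of_real (deriv Y x) * of_real (Y x) powr of_real \<alpha> *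
     of_real (\<Sum>j\<le>n. 1 / fact j * ((real n + \<alpha>) gchoose (n - j)) * Y x ^ j * k0 ^ (n - j))"

definition laguerre_form :: "(real \<Rightarrow> real) \<Rightarrow> real \<Rightarrow> real \<Rightarrow> nat \<Rightarrow> real \<Rightarrow> complex" where
  "laguerre_form Y k0 \<alpha> n x =
     of_real (deriv Y x) * of_real (Y x) powr of_real \<alpha> *
     of_real (laguerre \<alpha> n (- (Y x / k0)))"

definition diffop ::
  "(real \<Rightarrow> real) \<Rightarrow> real \<Rightarrow> real \<Rightarrow> (real \<Rightarrow> complex) \<Rightarrow> real \<Rightarrow> complex" where
  "diffop Y k0 \<alpha> u x =
    (let Y0 = Y x; Y1 = deriv Y x; Y2 = (deriv ^^ 2) Y x; Y3 = (deriv ^^ 3) Y x;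
         u' = (\<lambda>t. vector_derivative u (at t))
     in of_real (k0 / Y1 ^ 2 * Y0) * vector_derivative u' (at x)
      + of_real (1 / Y1 ^ 3 * ((Y0 + k0 * (1 - \<alpha>)) * Y1 ^ 2 - 3 * k0 * Y0 * Y2)) * u' x
      - of_real (1 / Y1 ^ 4 * (k0 * Y0 * (Y1 * Y3 - 3 * Y2 ^ 2)
                    + (k0 * (1 - \<alpha>) + Y0) * Y1 ^ 2 * Y2 - (1 - \<alpha>) * Y1 ^ 4)) * u x)"

definition bdry :: "(real \<Rightarrow> real) \<Rightarrow> real \<Rightarrow> (real \<Rightarrow> complex) \<Rightarrow> real \<Rightarrow> complex" where
  "bdry Y \<alpha> u x =
    (let Y0 = Y x; Y1 = deriv Y x; Y2 = (deriv ^^ 2) Y x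
     in of_real (1 / Y1 ^ 3) * (of_real (Y0 * Y1) * vector_derivative u (at x)
                                 - of_real (\<alpha> * Y1 ^ 2 + Y0 * Y2) * u x))"

text \<open>
  The boundary value is a limit from the right, since \<open>u'\<close> and, for \<open>\<alpha> < 0\<close>, even \<open>u\<close> may be singular at \<open>0\<close>.
  Differentiability is required explicitly because \<^const>\<open>vector_derivative\<close> is total.
\<close>

definition solves_eigenproblem ::
  "(real \<Rightarrow> real) \<Rightarrow> real \<Rightarrow> real \<Rightarrow> real \<Rightarrow> (real \<Rightarrow> complex) \<Rightarrow> bool" where
  "solves_eigenproblem Y k0 \<alpha> lam u \<longleftrightarrow>
     (\<forall>x>0. u differentiable (at x)
          \<and> (\<lambda>t. vector_derivative u (at t)) differentiable (at x)
          \<and> diffop Y k0 \<alpha> u x = of_real lam * u x)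
     \<and> (bdry Y \<alpha> u \<longlongrightarrow> 0) (at_right 0)"

definition weight :: "(real \<Rightarrow> real) \<Rightarrow> real \<Rightarrow> real \<Rightarrow> real \<Rightarrow> complex" where
  "weight Y k0 \<alpha> x =
     of_real (Y x) powr of_real (- \<alpha>) / of_real \<bar>deriv Y x\<bar> * of_real (exp (1 / k0 * Y x))"

text \<open>
  The factor relating the weighted integral of \<open>(M^n u0)^2\<close> to \<open>(- k0)^\<alpha>\<close>: substituting \<open>z = - Y / k0\<close>
  contributes \<open>\<bar>k0\<bar>\<close>, the Laguerre polynomials have squared norm \<open>\<Gamma>(\<alpha> + 1) binom(n + \<alpha>, n)\<close>, and
  the \<open>n\<close>-th monomial carries the constant \<open>k0^n / binom(n + \<alpha>, n)\<close>.
\<close>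

definition norm_factor :: "real \<Rightarrow> real \<Rightarrow> nat \<Rightarrow> real" where
  "norm_factor k0 \<alpha> n = \<bar>k0\<bar> * k0 ^ (2 * n) * Gamma (\<alpha> + 1) / ((real n + \<alpha>) gchoose n)"

end

theory Submission
  imports Defs
begin

text \<open>
  In the variable \<open>z = - Y / k0\<close>, which maps the half-line increasingly onto itself, the principal power
  \<open>Y powr \<alpha>\<close> becomes a constant times the real power \<open>z powr \<alpha>\<close>. Writing \<open>u = Y' v(z)\<close> turns the
  differential operator into Laguerre's, and \<open>M\<close> into the map
  \<open>p \<mapsto> k0 (p - z powr (- \<alpha>) \<integral> s powr \<alpha> p(s) ds)\<close> on the polynomial factor \<open>p\<close> of
  \<open>v = z powr \<alpha> p\<close>; by Pascal's rule, iterating it from \<open>p = 1\<close> gives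
  \<open>k0 ^ n \<Sum>j. (-1) ^ j binom(n, j) z ^ j / (\<alpha> + 1)\<^sub>j\<close>, a multiple of the \<open>n\<close>-th Laguerre polynomial.
  Orthogonality is a Gamma integral followed by an \<open>n\<close>-th finite difference of a rising factorial of
  degree at most \<open>n\<close>.
\<close>

section \<open>Laguerre polynomials scaled to 1 at zero: recursion, primitive, differential
  equation\<close>

text \<open>This is Kummer's polynomial \<open>1F1(-n; \<alpha> + 1; z)\<close>.\<close>

definition scaled_laguerre :: "real \<Rightarrow> nat \<Rightarrow> real poly" where
  "scaled_laguerre \<alpha> n =
     (\<Sum>j\<le>n. monom ((-1) ^ j * real (n choose j) / pochhammer (\<alpha> + 1) j) j)"

text \<open>\<open>s powr (\<alpha> + 1) * poly (laguerre_primitive \<alpha> n) s\<close> is a primitive of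
  \<open>s powr \<alpha> * poly (scaled_laguerre \<alpha> n) s\<close>.\<close>

definition laguerre_primitive :: "real \<Rightarrow> nat \<Rightarrow> real poly" where
  "laguerre_primitive \<alpha> n =
     (\<Sum>j\<le>n. monom ((-1) ^ j * real (n choose j) / pochhammer (\<alpha> + 1) (Suc j)) j)"

lemma pochhammer_pos_shift:
  fixes \<alpha> :: real
  assumes "\<alpha> > -1"
  shows "pochhammer (\<alpha> + 1) n > 0"
  by (rule pochhammer_pos) (use assms in simp)

text \<open>\<open>n choose i\<close> vanishes for \<open>i > n\<close>, so the formula holds at
  every index and later coefficient comparisons need no split at the degree.\<close>

lemma coeff_sum_monom_choose:
  "coeff (\<Sum>j\<le>n. monom (a j * real (n choose j) / b j) j) i = a i * real (n choose i) / b i"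
  by (cases "i \<le> n") (simp_all add: coeff_sum)

lemma coeff_scaled_laguerre:
  "coeff (scaled_laguerre \<alpha> n) j = (-1) ^ j * real (n choose j) / pochhammer (\<alpha> + 1) j"
  unfolding scaled_laguerre_def by (rule coeff_sum_monom_choose)

lemma coeff_laguerre_primitive:
  "coeff (laguerre_primitive \<alpha> n) j =
     (-1) ^ j * real (n choose j) / pochhammer (\<alpha> + 1) (Suc j)"
  unfolding laguerre_primitive_def by (rule coeff_sum_monom_choose)

lemma poly_scaled_laguerre:
  "poly (scaled_laguerre \<alpha> n) z =
     (\<Sum>j\<le>n. (-1) ^ j * real (n choose j) / pochhammer (\<alpha> + 1) j * z ^ j)"
  by (simp add: scaled_laguerre_def poly_sum poly_monom)

lemma scaled_laguerre_0 [simp]: "scaled_laguerre \<alpha> 0 = 1"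
  by (simp add: scaled_laguerre_def)

text \<open>Pascal's rule in each coefficient: the shift by \<open>pCons 0\<close> flips the sign
  and lines up the denominators, which is why \<open>pochhammer_Suc\<close> stays folded. Up to the
  factor \<open>k0\<close> this is one application of \<open>M\<close>.\<close>

lemma scaled_laguerre_Suc:
  assumes "\<alpha> > -1"
  shows "scaled_laguerre \<alpha> (Suc n) = scaled_laguerre \<alpha> n - pCons 0 (laguerre_primitive \<alpha> n)"
proof (rule poly_eqI)
  fix i
  show "coeff (scaled_laguerre \<alpha> (Suc n)) i =
        coeff (scaled_laguerre \<alpha> n - pCons 0 (laguerre_primitive \<alpha> n)) i"
    by (cases i) (simp_all add: coeff_scaled_laguerre coeff_laguerre_primitive coeff_pCons
        diff_divide_distrib add_divide_distrib algebra_simps del: pochhammer_Suc)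
qed

text \<open>On \<open>z ^ i\<close> the operator on the left is multiplication by
  \<open>\<alpha> + 1 + i\<close>, the last factor of
  \<open>pochhammer (\<alpha> + 1) (Suc i)\<close>.\<close>

lemma laguerre_primitive_eq:
  assumes "\<alpha> > -1"
  shows "smult (\<alpha> + 1) (laguerre_primitive \<alpha> n) + pCons 0 (pderiv (laguerre_primitive \<alpha> n))
         = scaled_laguerre \<alpha> n"
proof (rule poly_eqI)
  fix i
  have *: "pochhammer (\<alpha> + 1) (Suc i) = pochhammer (\<alpha> + 1) i * (\<alpha> + 1 + real i)"
    by (simp add: pochhammer_Suc)
  have "\<alpha> + 1 + real i \<noteq> 0" "pochhammer (\<alpha> + 1) i \<noteq> 0"
    using assms pochhammer_pos_shift[OF assms, of i] by auto
  then have "(\<alpha> + 1 + real i) * coeff (laguerre_primitive \<alpha> n) i = coeff (scaled_laguerre \<alpha> n) i"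
    unfolding coeff_scaled_laguerre coeff_laguerre_primitive * by simp
  then show "coeff (smult (\<alpha> + 1) (laguerre_primitive \<alpha> n) + pCons 0 (pderiv (laguerre_primitive \<alpha> n))) i
      = coeff (scaled_laguerre \<alpha> n) i"
    by (cases i) (simp_all add: coeff_pderiv algebra_simps)
qed

text \<open>Comparing coefficients reduces Laguerre's equation to the two-term recurrence
  \<open>rec\<close>.\<close>

lemma scaled_laguerre_ode:
  fixes n :: nat
  assumes "\<alpha> > -1"
  defines "q \<equiv> scaled_laguerre \<alpha> n"
  shows "z * poly (pderiv (pderiv q)) z + (1 + \<alpha> - z) * poly (pderiv q) z + real n * poly q z = 0"
proof -
  have rec: "real (Suc i) * (\<alpha> + 1 + real i) * coeff q (Suc i) = (real i - real n) * coeff q i" for i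
  proof -
    \<comment> \<open>The case split turns the truncated difference \<open>n - i\<close> into a real
      one; past \<open>n\<close> both binomial coefficients are zero.\<close>
    have choose: "real (Suc i) * real (n choose Suc i) = (real n - real i) * real (n choose i)"
    proof (cases "i \<le> n")
      case True
      have "Suc i * (n choose Suc i) = (n - i) * (n choose i)"
        by (metis binomial_absorb_comp binomial_absorption mult.commute)
      then show ?thesis
        using True by (metis of_nat_diff of_nat_mult)
    next
      case False
      then show ?thesis by (simp add: binomial_eq_0)
    qed
    have "\<alpha> + 1 + real i \<noteq> 0"
      using assms by simp
    then have "real (Suc i) * (\<alpha> + 1 + real i) * coeff q (Suc i) =
        - ((-1) ^ i) * (real (Suc i) * real (n choose Suc i)) / pochhammer (\<alpha> + 1) i"
      unfolding q_def coeff_scaled_laguerre pochhammer_Suc by simp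
    also have "\<dots> = (real i - real n) * coeff q i"
      unfolding choose q_def coeff_scaled_laguerre by (simp add: algebra_simps diff_divide_distrib)
    finally show ?thesis .
  qed
  have "pCons 0 (pderiv (pderiv q)) + smult (1 + \<alpha>) (pderiv q) - pCons 0 (pderiv q) + smult (real n) q = 0"
  proof (rule poly_eqI)
    fix i
    show "coeff (pCons 0 (pderiv (pderiv q)) + smult (1 + \<alpha>) (pderiv q) - pCons 0 (pderiv q)
        + smult (real n) q) i = coeff 0 i"
      using rec[of i] by (cases i) (simp_all add: coeff_pderiv algebra_simps)
  qed
  then have "poly (pCons 0 (pderiv (pderiv q)) + smult (1 + \<alpha>) (pderiv q) - pCons 0 (pderiv q)
      + smult (real n) q) z = 0"
    by simp
  then show ?thesis
    by (simp add: algebra_simps)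
qed

section \<open>Passage to the classical Laguerre polynomials\<close>

lemma gbinomial_shift:
  "(real n + \<alpha>) gchoose m = pochhammer (\<alpha> + 1 + real n - real m) m / fact m"
  by (simp add: gbinomial_pochhammer' algebra_simps)

lemma gbinomial_add_self:
  "(real n + \<alpha>) gchoose n = pochhammer (\<alpha> + 1) n / fact n"
  by (simp add: gbinomial_shift)

lemma gbinomial_add_self_pos: "\<alpha> > -1 \<Longrightarrow> ((real n + \<alpha>) gchoose n) > 0"
  by (simp add: gbinomial_add_self pochhammer_pos_shift)

text \<open>The rising factorial of length \<open>n\<close> splits at \<open>j\<close>; its upper
  block of \<open>n - j\<close> factors is the numerator of the generalized binomial coefficient in
  \<open>laguerre\<close>.\<close>

lemma laguerre_eq_scaled:
  assumes "\<alpha> > -1"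
  shows "laguerre \<alpha> n z = ((real n + \<alpha>) gchoose n) * poly (scaled_laguerre \<alpha> n) z"
  unfolding laguerre_def poly_scaled_laguerre sum_distrib_left
proof (rule sum.cong[OF refl])
  fix j assume "j \<in> {..n}"
  then have j: "j \<le> n" by simp
  have "pochhammer (\<alpha> + 1) n = pochhammer (\<alpha> + 1) j * pochhammer (\<alpha> + 1 + real j) (n - j)"
    by (rule pochhammer_product[OF j])
  moreover have "pochhammer (\<alpha> + 1) j \<noteq> 0"
    using pochhammer_pos_shift[OF assms, of j] by simp
  moreover have "\<alpha> + 1 + real n - real (n - j) = \<alpha> + 1 + real j"
    using j by simp
  ultimately show "(-1) ^ j / fact j * ((real n + \<alpha>) gchoose (n - j)) * z ^ j =
      ((real n + \<alpha>) gchoose n) * ((-1) ^ j * real (n choose j) / pochhammer (\<alpha> + 1) j * z ^ j)"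
    unfolding gbinomial_shift[of n \<alpha> "n - j"] gbinomial_add_self
    using j by (simp add: binomial_fact add.assoc)
qed

section \<open>Orthogonality by finite differences and Gamma integrals\<close>

text \<open>Pascal's rule again; it lets finite differences be taken one order at a time.\<close>

lemma alternating_choose_Suc:
  fixes f :: "nat \<Rightarrow> real"
  shows "(\<Sum>i\<le>Suc n. (-1) ^ i * real (Suc n choose i) * f i) =
         (\<Sum>i\<le>n. (-1) ^ i * real (n choose i) * (f i - f (Suc i)))"
proof -
  have "(\<Sum>i\<le>Suc n. (-1) ^ i * real (Suc n choose i) * f i) =
      f 0 + (\<Sum>i\<le>n. (-1) ^ Suc i * real (n choose Suc i) * f (Suc i))
          - (\<Sum>i\<le>n. (-1) ^ i * real (n choose i) * f (Suc i))"
    by (subst sum.atMost_Suc_shift) (simp add: sum.distrib[symmetric] sum_subtractf[symmetric] algebra_simps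
        sum_negf[symmetric] del: sum.atMost_Suc)
  \<comment> \<open>Since \<open>n choose Suc n\<close> is zero, the top term can be carried along
    here and dropped in the next step.\<close>
  also have "f 0 + (\<Sum>i\<le>n. (-1) ^ Suc i * real (n choose Suc i) * f (Suc i)) =
      (\<Sum>i\<le>Suc n. (-1) ^ i * real (n choose i) * f i)"
    by (simp add: sum.atMost_Suc_shift del: sum.atMost_Suc)
  also have "\<dots> = (\<Sum>i\<le>n. (-1) ^ i * real (n choose i) * f i)"
    by simp
  finally show ?thesis
    by (simp add: sum_subtractf algebra_simps)
qed

text \<open>Each difference lowers the degree of the rising factorial by one and moves its base to
  \<open>a + 1\<close>, hence the general \<open>a\<close> in the induction. So \<open>n\<close>
  differences kill degrees below \<open>n\<close> and leave a constant at degree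
  \<open>n\<close>.\<close>

lemma alternating_sum_pochhammer:
  fixes a :: real
  assumes "k \<le> n"
  shows "(\<Sum>i\<le>n. (-1) ^ i * real (n choose i) * pochhammer (a + real i) k)
         = of_bool (k = n) * ((-1) ^ n * fact n)"
  using assms
proof (induction n arbitrary: k a)
  case 0
  then show ?case by simp
next
  case (Suc n)
  show ?case
  proof (cases k)
    case 0
    then show ?thesis
      unfolding alternating_choose_Suc by simp
  next
    case (Suc l)
    \<comment> \<open>Both terms contain \<open>pochhammer (a + 1 + real i) l\<close>; the remaining
      linear factors \<open>a + i\<close> and \<open>a + i + 1 + l\<close> differ by
      \<open>Suc l\<close>.\<close>
    have diff: "pochhammer (a + real i) (Suc l) - pochhammer (a + real (Suc i)) (Suc l)
        = - real (Suc l) * pochhammer (a + 1 + real i) l" for i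
      by (subst pochhammer_rec, subst pochhammer_rec') (simp add: algebra_simps)
    have "(\<Sum>i\<le>Suc n. (-1) ^ i * real (Suc n choose i) * pochhammer (a + real i) k)
        = - real (Suc l) * (\<Sum>i\<le>n. (-1) ^ i * real (n choose i) * pochhammer (a + 1 + real i) l)"
      unfolding alternating_choose_Suc Suc diff by (simp add: sum_distrib_left algebra_simps)
    then show ?thesis
      using Suc.IH[of l "a + 1"] Suc.prems Suc by (auto simp: algebra_simps)
  qed
qed

lemma Gamma_add_nat:
  fixes a :: real
  assumes "a > 0"
  shows "Gamma (a + real n) = pochhammer a n * Gamma a"
proof -
  have "a \<notin> \<int>\<^sub>\<le>\<^sub>0"
    using assms nonpos_Ints_nonpos[of a] by auto
  then show ?thesis
    using pochhammer_Gamma[of a n] Gamma_real_pos[OF assms] by (simp add: field_simps)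
qed

text \<open>The Gamma value equals \<open>Gamma (\<alpha> + 1)\<close> times
  \<open>pochhammer (\<alpha> + 1) i\<close>, which cancels the denominator of \<open>b n i\<close>,
  times \<open>pochhammer (\<alpha> + 1 + i) j\<close>. The inner sum is thus an \<open>n\<close>-th
  difference in degree \<open>j \<le> m \<le> n\<close>, and only \<open>j = n\<close>
  survives.\<close>

lemma sum_scaled_laguerre_Gamma:
  fixes m n :: nat
  assumes \<alpha>: "\<alpha> > -1" and mn: "m \<le> n"
  defines "b \<equiv> \<lambda>n. coeff (scaled_laguerre \<alpha> n)"
  shows "(\<Sum>j\<le>m. \<Sum>i\<le>n. b m j * b n i * Gamma (\<alpha> + 1 + real i + real j))
    = of_bool (m = n) * (Gamma (\<alpha> + 1) / ((real n + \<alpha>) gchoose n))"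
proof -
  have inner: "(\<Sum>i\<le>n. b m j * b n i * Gamma (\<alpha> + 1 + real i + real j))
      = b m j * Gamma (\<alpha> + 1) * (of_bool (j = n) * ((-1) ^ n * fact n))" if "j \<le> m" for j
  proof -
    have "b n i * Gamma (\<alpha> + 1 + real i + real j) =
        Gamma (\<alpha> + 1) * ((-1) ^ i * real (n choose i) * pochhammer (\<alpha> + 1 + real i) j)" for i
      using \<alpha> pochhammer_pos_shift[OF \<alpha>, of i]
      by (simp add: b_def coeff_scaled_laguerre Gamma_add_nat)
    then have "(\<Sum>i\<le>n. b m j * b n i * Gamma (\<alpha> + 1 + real i + real j)) = b m j * Gamma (\<alpha> + 1) *
        (\<Sum>i\<le>n. (-1) ^ i * real (n choose i) * pochhammer (\<alpha> + 1 + real i) j)"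
      by (simp add: sum_distrib_left mult.assoc)
    then show ?thesis
      using that mn by (simp add: alternating_sum_pochhammer)
  qed
  have "(\<Sum>j\<le>m. \<Sum>i\<le>n. b m j * b n i * Gamma (\<alpha> + 1 + real i + real j))
      = (\<Sum>j\<le>m. b m j * Gamma (\<alpha> + 1) * (of_bool (j = n) * ((-1) ^ n * fact n)))"
    by (rule sum.cong) (simp_all add: inner)
  also have "\<dots> = (\<Sum>j\<le>m. if j = n then b m n * Gamma (\<alpha> + 1) * ((-1) ^ n * fact n) else 0)"
    by (rule sum.cong) auto
  also have "\<dots> = of_bool (m = n) * (Gamma (\<alpha> + 1) / ((real n + \<alpha>) gchoose n))"
    unfolding gbinomial_add_self using mn
    by (auto simp: b_def coeff_scaled_laguerre field_simps)
  finally show ?thesis .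
qed

text \<open>Mediates between the Gamma integral on the closed half-line and the open one, where the
  substitution is differentiable.\<close>

lemma has_integral_atLeast_eq_greaterThan:
  fixes a :: real and f :: "real \<Rightarrow> 'a::banach"
  shows "(f has_integral y) {a..} \<longleftrightarrow> (f has_integral y) {a<..}"
  by (rule has_integral_spike_set_eq) (auto intro: negligible_subset[of "{a}"])

text \<open>Absolute integrability accompanies the value because the later change of variables
  transports the two together.\<close>

lemma scaled_laguerre_orthogonal:
  assumes \<alpha>: "\<alpha> > -1"
  shows "(\<lambda>s. s powr \<alpha> * exp (- s) * poly (scaled_laguerre \<alpha> m) s * poly (scaled_laguerre \<alpha> n) s)
           absolutely_integrable_on {0<..} \<and>
         integral {0<..} (\<lambda>s. s powr \<alpha> * exp (- s) * poly (scaled_laguerre \<alpha> m) s * poly (scaled_laguerre \<alpha> n) s)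
           = of_bool (m = n) * (Gamma (\<alpha> + 1) / ((real n + \<alpha>) gchoose n))"
    (is "?f m n absolutely_integrable_on _ \<and> integral _ (?f m n) = ?c m n")
proof -
  \<comment> \<open>Differences are taken in the larger index; symmetry of the integrand covers the
    other order.\<close>
  have wlog: "?f m n absolutely_integrable_on {0<..} \<and> integral {0<..} (?f m n) = ?c m n"
    if "m \<le> n" for m n
  proof -
    define b where "b = (\<lambda>n. coeff (scaled_laguerre \<alpha> n))"
    \<comment> \<open>The exponent keeps its trailing \<open>- 1\<close> to match the Gamma
      integrand.\<close>
    define g where "g = (\<lambda>i j s. b m j * b n i * (s powr (\<alpha> + 1 + real i + real j - 1) / exp s))"
    have f_eq: "?f m n s = (\<Sum>j\<le>m. \<Sum>i\<le>n. g i j s)" if "s > 0" for s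
    proof -
      have p: "poly (scaled_laguerre \<alpha> k) s = (\<Sum>i\<le>k. b k i * s ^ i)" for k
        by (simp add: poly_scaled_laguerre b_def coeff_scaled_laguerre)
      have "g i j s = s powr \<alpha> * exp (- s) * ((b m j * s ^ j) * (b n i * s ^ i))" for i j
        using that by (simp add: g_def powr_add powr_realpow exp_minus field_simps)
      then show ?thesis
        unfolding p mult.assoc[of "_ * _"] sum_product by (simp add: sum_distrib_left)
    qed
    have hi: "(g i j has_integral b m j * b n i * Gamma (\<alpha> + 1 + real i + real j)) {0<..}" for i j
    proof -
      have "\<alpha> + 1 + real i + real j > 0" using \<alpha> by simp
      then have "(g i j has_integral b m j * b n i * Gamma (\<alpha> + 1 + real i + real j)) {0..}"
        unfolding g_def by (intro has_integral_mult_right Gamma_integral_real)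
      then show ?thesis
        by (simp add: has_integral_atLeast_eq_greaterThan)
    qed
    have ai: "g i j absolutely_integrable_on {0<..}" for i j
    proof -
      have "(\<lambda>s. s powr (\<alpha> + 1 + real i + real j - 1) / exp s) absolutely_integrable_on {0<..}"
      proof (rule nonnegative_absolutely_integrable_1)
        have "\<alpha> + 1 + real i + real j > 0" using \<alpha> by simp
        from Gamma_integral_real[OF this]
        have "((\<lambda>s. s powr (\<alpha> + 1 + real i + real j - 1) / exp s) has_integral
            Gamma (\<alpha> + 1 + real i + real j)) {0<..}"
          by (simp add: has_integral_atLeast_eq_greaterThan)
        then show "(\<lambda>s. s powr (\<alpha> + 1 + real i + real j - 1) / exp s) integrable_on {0<..}"
          by blast
      qed auto
      then show ?thesis
        unfolding g_def by (rule set_integrable_mult_right)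
    qed
    have "(\<lambda>s. \<Sum>j\<le>m. \<Sum>i\<le>n. g i j s) absolutely_integrable_on {0<..}"
      by (intro absolutely_integrable_sum ai finite_atMost)
    then have "?f m n absolutely_integrable_on {0<..}"
      by (rule absolutely_integrable_spike[where S="{}"]) (simp_all add: f_eq)
    moreover have "((\<lambda>s. \<Sum>j\<le>m. \<Sum>i\<le>n. g i j s) has_integral
        (\<Sum>j\<le>m. \<Sum>i\<le>n. b m j * b n i * Gamma (\<alpha> + 1 + real i + real j))) {0<..}"
      by (intro has_integral_sum hi finite_atMost)
    then have "(?f m n has_integral
        (\<Sum>j\<le>m. \<Sum>i\<le>n. b m j * b n i * Gamma (\<alpha> + 1 + real i + real j))) {0<..}"
      by (rule has_integral_eq[rotated]) (simp only: f_eq greaterThan_iff)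
    moreover have "(\<Sum>j\<le>m. \<Sum>i\<le>n. b m j * b n i * Gamma (\<alpha> + 1 + real i + real j)) = ?c m n"
      unfolding b_def by (rule sum_scaled_laguerre_Gamma[OF \<alpha> that])
    ultimately show ?thesis
      unfolding has_integral_iff by simp
  qed
  show ?thesis
  proof (cases "m \<le> n")
    case True
    then show ?thesis by (rule wlog)
  next
    case False
    then show ?thesis
      using wlog[of n m] by (auto simp: mult_ac)
  qed
qed

section \<open>Calculus of real powers times polynomials\<close>

definition pow_poly :: "real \<Rightarrow> real poly \<Rightarrow> real \<Rightarrow> real" where
  "pow_poly \<beta> q s = s powr \<beta> * poly q s"

text \<open>The polynomial factor of the derivative of \<open>s powr \<beta> * poly q s\<close>, with \<open>s powr (\<beta> - 1)\<close> split off.\<close>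

definition euler_op :: "real \<Rightarrow> real poly \<Rightarrow> real poly" where
  "euler_op \<beta> q = smult \<beta> q + pCons 0 (pderiv q)"

lemma pow_poly_has_derivative:
  assumes "s > 0"
  shows "(pow_poly \<beta> q has_real_derivative pow_poly (\<beta> - 1) (euler_op \<beta> q) s) (at s)"
proof -
  have "s powr \<beta> = s powr (\<beta> - 1) * s"
    using assms by (simp add: powr_diff)
  then show ?thesis
    unfolding pow_poly_def[abs_def] euler_op_def using assms
    by (auto intro!: derivative_eq_intros simp: algebra_simps)
qed

text \<open>Laguerre's equation rewritten for \<open>g = s powr \<alpha> * q\<close>: the three
  \<open>pow_poly\<close> terms are \<open>g''\<close>, \<open>g'\<close> and
  \<open>g\<close>.\<close>

lemma pow_poly_laguerre_ode:
  fixes n :: nat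
  assumes \<alpha>: "\<alpha> > -1" and s: "s > 0"
  defines "q \<equiv> scaled_laguerre \<alpha> n"
  shows "s * pow_poly (\<alpha> - 1 - 1) (euler_op (\<alpha> - 1) (euler_op \<alpha> q)) s
       + (1 - \<alpha> - s) * pow_poly (\<alpha> - 1) (euler_op \<alpha> q) s + (real n + \<alpha>) * pow_poly \<alpha> q s = 0"
    (is "?lhs = 0")
proof -
  \<comment> \<open>With the lowest power factored out, the claim is a polynomial identity in
    \<open>s\<close>.\<close>
  define p where "p = s powr (\<alpha> - 1 - 1)"
  have p: "s powr (\<alpha> - 1) = p * s" "s powr \<alpha> = p * s\<^sup>2"
    using s by (simp_all add: p_def powr_diff power2_eq_square)
  have "?lhs = p * s\<^sup>2 * (s * poly (pderiv (pderiv q)) s + (1 + \<alpha> - s) * poly (pderiv q) s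
      + real n * poly q s)"
    unfolding pow_poly_def p p_def[symmetric] euler_op_def
    by (simp add: pderiv_smult pderiv_add pderiv_pCons algebra_simps power2_eq_square)
  then show ?thesis
    using scaled_laguerre_ode[OF \<alpha>, of s n] by (simp add: q_def)
qed

text \<open>A positive real factor does not change the argument of \<open>c\<close>, so the
  principal logarithm splits without a branch correction.\<close>

lemma of_real_mult_powr:
  fixes c :: complex
  assumes "r > 0" "c \<noteq> 0"
  shows "(c * of_real r) powr of_real a = c powr of_real a * of_real (r powr a)"
  using assms Ln_times_of_real[OF assms]
  by (simp add: powr_def exp_add distrib_left mult.commute Ln_of_real exp_of_real[symmetric] del: exp_of_real)

lemma has_vector_derivative_of_real_mult:
  fixes c :: complex
  assumes "(f has_real_derivative f') (at x)"
  shows "((\<lambda>x. c * of_real (f x)) has_vector_derivative c * of_real f') (at x)"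
  using assms
  by (intro has_vector_derivative_mult_right has_vector_derivative_of_real)
     (simp add: has_real_derivative_iff_has_vector_derivative)

section \<open>The substitution \<open>z = - Y / k0\<close>\<close>

locale laguerre_gauge =
  fixes Y :: "real \<Rightarrow> real" and k0 \<alpha> :: real
  assumes Y_0: "Y 0 = 0"
    and Y_continuous: "continuous_on {0..} Y"
    and Y_differentiable: "\<And>i x. i < 3 \<Longrightarrow> 0 < x \<Longrightarrow> (deriv ^^ i) Y differentiable (at x)"
    and deriv_Y_nonzero: "\<And>x. 0 < x \<Longrightarrow> deriv Y x \<noteq> 0"
    and Y_at_bot: "filterlim (\<lambda>x. Y x / k0) at_bot at_top"
    and alpha_gt: "\<alpha> > -1"
begin

definition z :: "real \<Rightarrow> real" where
  "z x = - Y x / k0"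

definition C :: complex where
  "C = of_real (- k0) powr of_real \<alpha>"

text \<open>Division by zero yields 0 here, and a constant does not tend to minus infinity.\<close>

lemma k0_nonzero: "k0 \<noteq> 0"
proof
  assume "k0 = 0"
  then have "filterlim (\<lambda>x::real. 0::real) at_bot at_top"
    using Y_at_bot by simp
  then have "eventually (\<lambda>x::real. (0::real) \<le> -1) at_top"
    unfolding filterlim_at_bot by blast
  then show False by simp
qed

lemma C_nonzero: "C \<noteq> 0"
  using k0_nonzero by (simp add: C_def)

lemma z_at_top: "filterlim z at_top at_top"
  using Y_at_bot unfolding filterlim_uminus_at_bot z_def[abs_def] by simp

lemma z_0: "z 0 = 0"
  by (simp add: z_def Y_0)

lemma z_continuous: "continuous_on {0..} z"
  unfolding z_def[abs_def] by (intro continuous_intros Y_continuous) (simp add: k0_nonzero)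

lemma iterated_deriv:
  assumes "x > 0" "i < 3"
  shows "((deriv ^^ i) Y has_real_derivative (deriv ^^ Suc i) Y x) (at x)"
  using Y_differentiable[OF assms(2,1)] DERIV_deriv_iff_real_differentiable by auto

lemmas Y_derivs = iterated_deriv[where i=0, simplified] iterated_deriv[where i=1, simplified]
  iterated_deriv[where i=2, simplified]

lemma z_deriv: "x > 0 \<Longrightarrow> (z has_real_derivative - deriv Y x / k0) (at x)"
  unfolding z_def[abs_def] using Y_derivs(1)[of x] k0_nonzero
  by (auto intro!: derivative_eq_intros)

lemma z_deriv_pos:
  assumes "x > 0"
  shows "- deriv Y x / k0 > 0"
proof (rule ccontr)
  define d where "d = (\<lambda>x. - deriv Y x / k0)"
  assume "\<not> - deriv Y x / k0 > 0"
  then have dx: "d x < 0"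
    using deriv_Y_nonzero[OF assms] k0_nonzero by (auto simp: d_def not_less order_le_less)
  have "continuous_on {0<..} (deriv Y)"
    using Y_derivs(2) by (intro continuous_at_imp_continuous_on ballI) (auto dest: DERIV_isCont)
  then have cont: "continuous_on {0<..} d"
    unfolding d_def by (intro continuous_intros) (simp_all add: k0_nonzero)
  \<comment> \<open>The derivative never vanishes, so if it is negative once, then \<open>z\<close> decreases and cannot tend to infinity.\<close>
  have conn: "connected (d ` {0<..})"
    by (rule connected_continuous_image[OF cont]) simp
  have neg: "d y < 0" if "y > 0" for y
  proof (rule ccontr)
    assume "\<not> d y < 0"
    then have "0 \<in> d ` {0<..}"
      using conn[unfolded connected_iff_interval] dx assms that
      by (meson greaterThan_iff imageI less_imp_le not_less)
    then show False
      using deriv_Y_nonzero k0_nonzero by (auto simp: d_def)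
  qed
  have "z b < 0" if "b > 0" for b
  proof -
    have "z b < z 0"
    proof (rule DERIV_neg_imp_decreasing_open[OF that])
      show "\<exists>y. DERIV z t :> y \<and> y < 0" if "0 < t" "t < b" for t
        using z_deriv[OF that(1)] neg[OF that(1)] by (auto simp: d_def)
      show "continuous_on {0..b} z"
        by (rule continuous_on_subset[OF z_continuous]) auto
    qed
    then show ?thesis by (simp add: z_0)
  qed
  moreover have "eventually (\<lambda>b. z b \<ge> 0 \<and> b > 0) at_top"
    using z_at_top unfolding filterlim_at_top by (intro eventually_conj eventually_gt_at_top) blast
  then obtain b where "z b \<ge> 0" "b > 0"
    using eventually_happens'[OF trivial_limit_at_top_linorder] by blast
  ultimately show False by (simp add: not_less[symmetric])
qed

lemma z_less:
  assumes "0 \<le> a" "a < b"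
  shows "z a < z b"
proof (rule DERIV_pos_imp_increasing_open[OF assms(2)])
  show "\<exists>y. DERIV z t :> y \<and> y > 0" if "a < t" "t < b" for t
    using z_deriv[of t] z_deriv_pos[of t] assms that by auto
  show "continuous_on {a..b} z"
    by (rule continuous_on_subset[OF z_continuous]) (use assms in auto)
qed

lemma z_pos: "x > 0 \<Longrightarrow> z x > 0"
  using z_less[of 0 x] by (simp add: z_0)

lemma z_inj: "inj_on z {0<..}"
  by (rule linorder_inj_onI') (metis z_less greaterThan_iff less_imp_le less_irrefl)

text \<open>Surjectivity is the intermediate value theorem between \<open>z 0 = 0\<close> and the
  unbounded values at infinity; with \<open>z_inj\<close> this licenses the change of
  variables.\<close>

lemma z_image: "z ` {0<..} = {0<..}"
proof
  show "z ` {0<..} \<subseteq> {0<..}" using z_pos by auto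
  show "{0<..} \<subseteq> z ` {0<..}"
  proof
    fix y :: real assume "y \<in> {0<..}"
    then have y: "y > 0" by simp
    have "eventually (\<lambda>b. z b \<ge> y \<and> b > 0) at_top"
      using z_at_top unfolding filterlim_at_top by (intro eventually_conj eventually_gt_at_top) blast
    then obtain b where b: "z b \<ge> y" "b > 0"
      using eventually_happens'[OF trivial_limit_at_top_linorder] by blast
    have "continuous_on {0..b} z"
      by (rule continuous_on_subset[OF z_continuous]) auto
    with b y obtain x where "0 \<le> x" "x \<le> b" "z x = y"
      using IVT'[of z 0 y b] by (auto simp: z_0)
    then show "y \<in> z ` {0<..}"
      using y z_0 by (cases "x = 0") auto
  qed
qed

text \<open>As \<open>z x > 0\<close>, the sign of \<open>k0\<close> is absorbed into
  \<open>C\<close> and all remaining calculus is real.\<close>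

lemma Y_powr:
  assumes "x > 0"
  shows "complex_of_real (Y x) powr of_real \<alpha> = C * of_real (z x powr \<alpha>)"
proof -
  have "complex_of_real (Y x) = of_real (- k0) * of_real (z x)"
    unfolding of_real_mult[symmetric] using k0_nonzero by (simp add: z_def)
  then show ?thesis
    using of_real_mult_powr[OF z_pos[OF assms], of "of_real (- k0)" \<alpha>] k0_nonzero by (simp add: C_def)
qed

section \<open>The eigenvalue equation and the boundary condition\<close>

text \<open>The free constant \<open>A\<close> lets one proof serve the monomials, the sum and the
  Laguerre form.\<close>

lemma solves_eigenproblemI:
  assumes u: "\<And>x. x > 0 \<Longrightarrow>
      u x = A * of_real (deriv Y x * pow_poly \<alpha> (scaled_laguerre \<alpha> n) (z x))"
  shows "solves_eigenproblem Y k0 \<alpha> (real n + 1) u"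
proof -
  define q where "q = scaled_laguerre \<alpha> n"
  define g where "g = pow_poly \<alpha> q"
  \<comment> \<open>\<open>g1\<close> and \<open>g2\<close> are the first two derivatives of
    \<open>g\<close>; below, \<open>w1\<close> and \<open>w2\<close> are those of \<open>w\<close>,
    by the chain rule with \<open>z' = - Y1 / k0\<close>.\<close>
  define g1 where "g1 = pow_poly (\<alpha> - 1) (euler_op \<alpha> q)"
  define g2 where "g2 = pow_poly (\<alpha> - 1 - 1) (euler_op (\<alpha> - 1) (euler_op \<alpha> q))"
  define Y1 where "Y1 = deriv Y"
  define Y2 where "Y2 = (deriv ^^ 2) Y"
  define Y3 where "Y3 = (deriv ^^ 3) Y"
  define w where "w = (\<lambda>x. Y1 x * g (z x))"
  define w1 where "w1 = (\<lambda>x. Y2 x * g (z x) - Y1 x ^ 2 * g1 (z x) / k0)"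
  define w2 where "w2 = (\<lambda>x. Y3 x * g (z x) - 3 * Y1 x * Y2 x * g1 (z x) / k0
      + Y1 x ^ 3 * g2 (z x) / k0 ^ 2)"
  have dY: "(Y1 has_real_derivative Y2 x) (at x)" "(Y2 has_real_derivative Y3 x) (at x)"
    if "x > 0" for x
    using Y_derivs[OF that] unfolding Y1_def Y2_def Y3_def
    by (simp_all add: numeral_2_eq_2 numeral_3_eq_3)
  have dz: "(z has_real_derivative - Y1 x / k0) (at x)" if "x > 0" for x
    using z_deriv[OF that] by (simp add: Y1_def)
  have dg: "((\<lambda>x. g (z x)) has_real_derivative g1 (z x) * (- Y1 x / k0)) (at x)"
    "((\<lambda>x. g1 (z x)) has_real_derivative g2 (z x) * (- Y1 x / k0)) (at x)" if "x > 0" for x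
    unfolding g_def g1_def g2_def
    by (rule DERIV_chain2[OF pow_poly_has_derivative[OF z_pos[OF that]] dz[OF that]])+
  have dw: "(w has_real_derivative w1 x) (at x)" if "x > 0" for x
    unfolding w_def w1_def using dY[OF that] dg[OF that] k0_nonzero
    by (auto intro!: derivative_eq_intros simp: field_simps power2_eq_square)
  have dw1: "(w1 has_real_derivative w2 x) (at x)" if "x > 0" for x
    unfolding w1_def w2_def using dY[OF that] dg[OF that] k0_nonzero
    by (auto intro!: derivative_eq_intros simp: field_simps power2_eq_square power3_eq_cube)
  have u_w: "u x = A * of_real (w x)" if "x > 0" for x
    using u[OF that] by (simp add: w_def g_def q_def Y1_def)
  have du: "(u has_vector_derivative A * of_real (w1 x)) (at x)" if "x > 0" for x
    using has_vector_derivative_of_real_mult[OF dw[OF that], of A]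
    by (rule has_vector_derivative_transform_within_open[where S="{0<..}"])
       (use that u_w in auto)
  have vdu: "vector_derivative u (at x) = A * of_real (w1 x)" if "x > 0" for x
    by (rule vector_derivative_at[OF du[OF that]])
  have ddu: "((\<lambda>t. vector_derivative u (at t)) has_vector_derivative A * of_real (w2 x)) (at x)"
    if "x > 0" for x
    using has_vector_derivative_of_real_mult[OF dw1[OF that], of A]
    by (rule has_vector_derivative_transform_within_open[where S="{0<..}"])
       (use that vdu in auto)
  have vddu: "vector_derivative (\<lambda>t. vector_derivative u (at t)) (at x) = A * of_real (w2 x)"
    if "x > 0" for x
    by (rule vector_derivative_at[OF ddu[OF that]])
  have Yz: "Y x = - k0 * z x" for x
    using k0_nonzero by (simp add: z_def)
  have real_eq: "k0 / Y1 x ^ 2 * Y x * w2 x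
      + 1 / Y1 x ^ 3 * ((Y x + k0 * (1 - \<alpha>)) * Y1 x ^ 2 - 3 * k0 * Y x * Y2 x) * w1 x
      - 1 / Y1 x ^ 4 * (k0 * Y x * (Y1 x * Y3 x - 3 * Y2 x ^ 2)
          + (k0 * (1 - \<alpha>) + Y x) * Y1 x ^ 2 * Y2 x - (1 - \<alpha>) * Y1 x ^ 4) * w x
      = (real n + 1) * w x" (is "?L = _") if "x > 0" for x
  proof -
    have ode: "z x * g2 (z x) + (1 - \<alpha> - z x) * g1 (z x) + (real n + \<alpha>) * g (z x) = 0"
      using pow_poly_laguerre_ode[OF alpha_gt z_pos[OF that], of n]
      unfolding g_def g1_def g2_def q_def .
    have "Y1 x \<noteq> 0" using deriv_Y_nonzero[OF that] by (simp add: Y1_def)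
    \<comment> \<open>All terms with \<open>Y2\<close> and \<open>Y3\<close> cancel, leaving
      Laguerre's operator in \<open>z\<close>.\<close>
    then have "?L = Y1 x * (- (z x * g2 (z x)) + (z x - (1 - \<alpha>)) * g1 (z x) + (1 - \<alpha>) * g (z x))"
      using k0_nonzero unfolding Yz[of x] w_def w1_def w2_def
      by (simp add: divide_simps) algebra
    \<comment> \<open>The equation contributes \<open>n + \<alpha>\<close>, which adds up with
      \<open>1 - \<alpha>\<close> to the eigenvalue.\<close>
    also have "\<dots> = (real n + 1) * w x"
      using ode unfolding w_def by algebra
    finally show ?thesis .
  qed
  have "diffop Y k0 \<alpha> u x = of_real (real n + 1) * u x" if "x > 0" for x
  proof -
    have "diffop Y k0 \<alpha> u x = A * of_real (k0 / Y1 x ^ 2 * Y x * w2 x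
      + 1 / Y1 x ^ 3 * ((Y x + k0 * (1 - \<alpha>)) * Y1 x ^ 2 - 3 * k0 * Y x * Y2 x) * w1 x
      - 1 / Y1 x ^ 4 * (k0 * Y x * (Y1 x * Y3 x - 3 * Y2 x ^ 2)
          + (k0 * (1 - \<alpha>) + Y x) * Y1 x ^ 2 * Y2 x - (1 - \<alpha>) * Y1 x ^ 4) * w x)"
      unfolding diffop_def Let_def vddu[OF that] vdu[OF that] u_w[OF that]
        Y1_def[symmetric] Y2_def[symmetric] Y3_def[symmetric] of_real_add of_real_diff of_real_mult
      by (simp only: distrib_left right_diff_distrib mult_ac)
    then show ?thesis
      unfolding real_eq[OF that] u_w[OF that] by simp
  qed
  moreover have "(bdry Y \<alpha> u \<longlongrightarrow> 0) (at_right 0)"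
  proof -
    \<comment> \<open>The term \<open>\<alpha> * g\<close> removes the part of order
      \<open>z powr \<alpha>\<close>, which need not vanish at 0; what remains has exponent
      \<open>\<alpha> + 1 > 0\<close>.\<close>
    have bd: "bdry Y \<alpha> u x = A * of_real (z x powr (\<alpha> + 1) * poly (pderiv q) (z x))" if "x > 0" for x
    proof -
      have nz: "Y1 x \<noteq> 0" using deriv_Y_nonzero[OF that] by (simp add: Y1_def)
      have p: "z x powr (\<alpha> + 1) = z x powr \<alpha> * z x" "z x powr \<alpha> = z x * z x powr (\<alpha> - 1)"
        using z_pos[OF that] by (simp_all add: powr_add powr_diff)
      have "1 / Y1 x ^ 3 * (Y x * Y1 x * w1 x - (\<alpha> * Y1 x ^ 2 + Y x * Y2 x) * w x)
          = z x * g1 (z x) - \<alpha> * g (z x)"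
        using nz k0_nonzero unfolding Yz[of x] w_def w1_def
        by (simp add: divide_simps) algebra
      also have "\<dots> = z x powr (\<alpha> + 1) * poly (pderiv q) (z x)"
        unfolding g_def g1_def pow_poly_def euler_op_def p by (simp add: algebra_simps)
      finally have *: "1 / Y1 x ^ 3 * (Y x * Y1 x * w1 x - (\<alpha> * Y1 x ^ 2 + Y x * Y2 x) * w x)
          = z x powr (\<alpha> + 1) * poly (pderiv q) (z x)" .
      show ?thesis
        unfolding *[symmetric] bdry_def Let_def vdu[OF that] u_w[OF that]
          Y1_def[symmetric] Y2_def[symmetric] of_real_add of_real_diff of_real_mult
        by (simp only: distrib_left right_diff_distrib mult_ac)
    qed
    have z0: "(z \<longlongrightarrow> 0) (at_right 0)"
      using z_continuous unfolding continuous_on_def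
      by (metis atLeast_iff order_refl z_0 at_within_Ici_at_right)
    have "((\<lambda>x. z x powr (\<alpha> + 1) * poly (pderiv q) (z x)) \<longlongrightarrow> 0 * poly (pderiv q) 0) (at_right 0)"
    proof (rule tendsto_mult)
      have "\<forall>\<^sub>F x in at_right 0. 0 \<le> z x"
        unfolding eventually_at_filter by (rule always_eventually) (auto intro: less_imp_le z_pos)
      then have "((\<lambda>x. z x powr (\<alpha> + 1)) \<longlongrightarrow> 0 powr (\<alpha> + 1)) (at_right 0)"
        using alpha_gt by (intro tendsto_powr2[OF z0 tendsto_const]) auto
      then show "((\<lambda>x. z x powr (\<alpha> + 1)) \<longlongrightarrow> 0) (at_right 0)" by simp
      show "((\<lambda>x. poly (pderiv q) (z x)) \<longlongrightarrow> poly (pderiv q) 0) (at_right 0)"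
        by (intro tendsto_intros z0)
    qed
    then have "((\<lambda>x. A * of_real (z x powr (\<alpha> + 1) * poly (pderiv q) (z x))) \<longlongrightarrow> A * of_real 0)
        (at_right 0)"
      by (intro tendsto_intros) simp
    then have "((\<lambda>x. A * of_real (z x powr (\<alpha> + 1) * poly (pderiv q) (z x))) \<longlongrightarrow> 0) (at_right 0)"
      by simp
    then show ?thesis
      by (rule Lim_transform_eventually)
         (use bd in \<open>auto simp: eventually_at_filter intro!: always_eventually\<close>)
  qed
  ultimately show ?thesis
    unfolding solves_eigenproblem_def using du ddu
    by (auto intro: differentiableI_vector)
qed

section \<open>Iterating \<open>M\<close> and comparing the explicit forms\<close>

text \<open>The integrand may be singular at 0, but its primitive is continuous there and vanishes
  because \<open>\<alpha> + 1 > 0\<close>; hence the interior form of the fundamental theorem. The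
  factor \<open>- k0\<close> undoes \<open>z' = - Y' / k0\<close>.\<close>

lemma has_integral_mode:
  fixes u :: "real \<Rightarrow> complex"
  assumes u: "\<And>x. x > 0 \<Longrightarrow>
      u x = A * of_real (deriv Y x * pow_poly \<alpha> (scaled_laguerre \<alpha> n) (z x))"
    and x: "x > 0"
  shows "(u has_integral A * of_real (- k0 * pow_poly (\<alpha> + 1) (laguerre_primitive \<alpha> n) (z x))) {0..x}"
proof -
  define F where "F = (\<lambda>t. A * complex_of_real (- k0 * pow_poly (\<alpha> + 1) (laguerre_primitive \<alpha> n) (z t)))"
  have "(u has_integral F x - F 0) {0..x}"
  proof (rule fundamental_theorem_of_calculus_interior)
    show "0 \<le> x" using x by simp
    have zx: "continuous_on {0..x} z"
      by (rule continuous_on_subset[OF z_continuous]) auto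
    have "continuous_on {0..x} (\<lambda>t. z t powr (\<alpha> + 1))"
      by (rule continuous_on_powr'[OF zx continuous_on_const])
         (use alpha_gt z_pos z_0 in \<open>auto simp: order_le_less\<close>)
    then show "continuous_on {0..x} F"
      unfolding F_def pow_poly_def
      by (intro continuous_on_mult continuous_on_const continuous_on_of_real continuous_on_poly zx)
    show "(F has_vector_derivative u t) (at t)" if "t \<in> {0<..<x}" for t
    proof -
      have t: "t > 0" using that by simp
      have "((\<lambda>t. - k0 * pow_poly (\<alpha> + 1) (laguerre_primitive \<alpha> n) (z t)) has_real_derivative
          - k0 * (pow_poly (\<alpha> + 1 - 1) (euler_op (\<alpha> + 1) (laguerre_primitive \<alpha> n)) (z t)
            * (- deriv Y t / k0))) (at t)"
        by (intro DERIV_cmult DERIV_chain2[OF pow_poly_has_derivative[OF z_pos[OF t]] z_deriv[OF t]])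
      then have "((\<lambda>t. - k0 * pow_poly (\<alpha> + 1) (laguerre_primitive \<alpha> n) (z t)) has_real_derivative
          deriv Y t * pow_poly \<alpha> (scaled_laguerre \<alpha> n) (z t)) (at t)"
        using k0_nonzero by (simp add: euler_op_def laguerre_primitive_eq[OF alpha_gt] mult.commute)
      from has_vector_derivative_of_real_mult[OF this, of A] show ?thesis
        unfolding F_def u[OF t] .
    qed
  qed
  then show ?thesis
    by (simp add: F_def pow_poly_def z_0)
qed

text \<open>Each application of \<open>M\<close> contributes \<open>k0\<close> times one step of
  \<open>scaled_laguerre_Suc\<close>. The induction keeps \<open>x\<close> general because
  \<open>Dinv\<close> uses the hypothesis on the whole interval.\<close>

lemma monomial_eq:
  assumes "x > 0"
  shows "monomial Y k0 \<alpha> n x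
    = C * of_real (k0 ^ n) * of_real (deriv Y x * pow_poly \<alpha> (scaled_laguerre \<alpha> n) (z x))"
  using assms
proof (induction n arbitrary: x)
  case 0
  then show ?case
    by (simp add: monomial_def u0_def Y_powr pow_poly_def)
next
  case (Suc n)
  let ?p = "pow_poly (\<alpha> + 1) (laguerre_primitive \<alpha> n) (z x)"
  have "Dinv (monomial Y k0 \<alpha> n) x = C * of_real (k0 ^ n) * of_real (- k0 * ?p)"
    unfolding Dinv_def by (rule integral_unique[OF has_integral_mode[OF Suc.IH Suc.prems]])
  then have "monomial Y k0 \<alpha> (Suc n) x = of_real (deriv Y x) * (C * of_real (k0 ^ n) * of_real (- k0 * ?p))
      + of_real k0 * (C * of_real (k0 ^ n) * of_real (deriv Y x * pow_poly \<alpha> (scaled_laguerre \<alpha> n) (z x)))"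
    using Suc by (simp add: monomial_def Mop_def)
  also have "\<dots> = C * of_real (k0 ^ Suc n) *
      of_real (deriv Y x * (pow_poly \<alpha> (scaled_laguerre \<alpha> n) (z x) - ?p))"
    by (simp add: algebra_simps)
  also have "pow_poly \<alpha> (scaled_laguerre \<alpha> n) (z x) - ?p = pow_poly \<alpha> (scaled_laguerre \<alpha> (Suc n)) (z x)"
    using z_pos[OF Suc.prems]
    by (simp add: pow_poly_def scaled_laguerre_Suc[OF alpha_gt] powr_add algebra_simps)
  finally show ?case .
qed

lemma laguerre_form_eq:
  assumes "x > 0"
  shows "laguerre_form Y k0 \<alpha> n x
    = C * of_real ((real n + \<alpha>) gchoose n) * of_real (deriv Y x * pow_poly \<alpha> (scaled_laguerre \<alpha> n) (z x))"
proof -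
  have "- (Y x / k0) = z x" by (simp add: z_def)
  then show ?thesis
    by (simp add: laguerre_form_def Y_powr[OF assms] laguerre_eq_scaled[OF alpha_gt] pow_poly_def)
qed

text \<open>The sum is homogeneous of degree \<open>n\<close> in \<open>Y\<close> and
  \<open>k0\<close>; after extracting \<open>k0 ^ n\<close>, the signs of the Laguerre coefficients
  cancel those of \<open>- Y / k0\<close>.\<close>

lemma sum_form_eq_laguerre_form: "sum_form Y k0 \<alpha> n x = of_real (k0 ^ n) * laguerre_form Y k0 \<alpha> n x"
proof -
  have "(\<Sum>j\<le>n. 1 / fact j * ((real n + \<alpha>) gchoose (n - j)) * Y x ^ j * k0 ^ (n - j))
      = k0 ^ n * laguerre \<alpha> n (- (Y x / k0))"
    unfolding laguerre_def sum_distrib_left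
  proof (rule sum.cong[OF refl])
    fix j assume "j \<in> {..n}"
    then have "k0 ^ n = k0 ^ (n - j) * k0 ^ j" by (simp add: power_add[symmetric])
    then have "Y x ^ j * k0 ^ (n - j) = k0 ^ n * ((-1) ^ j * (- (Y x / k0)) ^ j)"
      using k0_nonzero by (simp add: power_mult_distrib[symmetric] power_divide)
    then show "1 / fact j * ((real n + \<alpha>) gchoose (n - j)) * Y x ^ j * k0 ^ (n - j) =
        k0 ^ n * ((-1) ^ j / fact j * ((real n + \<alpha>) gchoose (n - j)) * (- (Y x / k0)) ^ j)"
      by (simp add: mult_ac)
  qed
  then show ?thesis
    by (simp add: sum_form_def laguerre_form_def mult_ac)
qed

section \<open>Orthogonality of the monomials\<close>

text \<open>The two monomials give \<open>C\<close> and \<open>z powr \<alpha>\<close> squared and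
  the weight divides by each once. Likewise \<open>Y'\<close> squared over its modulus leaves the
  Jacobian of \<open>z\<close> times the modulus of \<open>k0\<close>.\<close>

lemma weight_mult:
  assumes "x > 0"
  shows "weight Y k0 \<alpha> x * monomial Y k0 \<alpha> n x * monomial Y k0 \<alpha> m x
    = C * of_real (\<bar>k0\<bar> * k0 ^ (n + m) * (\<bar>- deriv Y x / k0\<bar> * (z x powr \<alpha> * exp (- z x) *
        poly (scaled_laguerre \<alpha> n) (z x) * poly (scaled_laguerre \<alpha> m) (z x))))"
proof -
  define d where "d = deriv Y x"
  define P where "P = z x powr \<alpha>"
  define p where "p = poly (scaled_laguerre \<alpha> n) (z x)"
  define r where "r = poly (scaled_laguerre \<alpha> m) (z x)"
  have nz: "d \<noteq> 0" "P \<noteq> 0"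
    using deriv_Y_nonzero[OF assms] z_pos[OF assms] by (simp_all add: d_def P_def)
  have w: "weight Y k0 \<alpha> x = inverse (C * of_real P) / of_real \<bar>d\<bar> * of_real (exp (- z x))"
    unfolding weight_def of_real_minus powr_minus Y_powr[OF assms] d_def P_def by (simp add: z_def)
  consider "d > 0" | "d < 0" using nz by fastforce
  then have "weight Y k0 \<alpha> x * monomial Y k0 \<alpha> n x * monomial Y k0 \<alpha> m x
      = C * of_real (k0 ^ (n + m) * \<bar>d\<bar> * (P * exp (- z x) * p * r))"
    unfolding w monomial_eq[OF assms] pow_poly_def d_def[symmetric] P_def[symmetric]
      p_def[symmetric] r_def[symmetric]
    using nz C_nonzero
    by cases (simp_all add: abs_of_pos abs_of_neg field_simps power_add)
  moreover have "\<bar>d\<bar> = \<bar>k0\<bar> * \<bar>- d / k0\<bar>"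
    using k0_nonzero by (simp add: abs_divide)
  ultimately show ?thesis
    unfolding d_def P_def p_def r_def by (simp only: mult_ac)
qed

lemma monomial_orthogonal:
  "((\<lambda>x. weight Y k0 \<alpha> x * monomial Y k0 \<alpha> n x * monomial Y k0 \<alpha> m x)
     has_integral C * of_real (norm_factor k0 \<alpha> n) * of_bool (m = n)) {0..}"
proof -
  let ?f = "\<lambda>s. s powr \<alpha> * exp (- s) * poly (scaled_laguerre \<alpha> n) s * poly (scaled_laguerre \<alpha> m) s"
  \<comment> \<open>Index \<open>m\<close> stands in the binomial because the polynomials occur in
    the order \<open>n\<close>, \<open>m\<close>; it matters only when they agree.\<close>
  define c where "c = of_bool (n = m) * (Gamma (\<alpha> + 1) / ((real m + \<alpha>) gchoose m))"
  have "(\<lambda>x. \<bar>- deriv Y x / k0\<bar> * ?f (z x)) absolutely_integrable_on {0<..} \<and>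
      integral {0<..} (\<lambda>x. \<bar>- deriv Y x / k0\<bar> * ?f (z x)) = c \<longleftrightarrow>
      ?f absolutely_integrable_on z ` {0<..} \<and> integral (z ` {0<..}) ?f = c"
  proof (rule has_absolute_integral_change_of_variables_1')
    show "(z has_field_derivative - deriv Y x / k0) (at x within {0<..})" if "x \<in> {0<..}" for x
      using z_deriv[of x] that by (simp add: has_field_derivative_at_within)
  qed (simp_all add: z_inj)
  moreover have "?f absolutely_integrable_on z ` {0<..} \<and> integral (z ` {0<..}) ?f = c"
    unfolding z_image c_def by (rule scaled_laguerre_orthogonal[OF alpha_gt])
  ultimately have "(\<lambda>x. \<bar>- deriv Y x / k0\<bar> * ?f (z x)) absolutely_integrable_on {0<..} \<and>
      integral {0<..} (\<lambda>x. \<bar>- deriv Y x / k0\<bar> * ?f (z x)) = c"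
    by blast
  then have "((\<lambda>x. \<bar>- deriv Y x / k0\<bar> * ?f (z x)) has_integral c) {0<..}"
    unfolding has_integral_iff by (blast intro: set_lebesgue_integral_eq_integral(1))
  then have "((\<lambda>x. C * of_real (\<bar>k0\<bar> * k0 ^ (n + m) * (\<bar>- deriv Y x / k0\<bar> * ?f (z x))))
      has_integral C * of_real (\<bar>k0\<bar> * k0 ^ (n + m) * c)) {0<..}"
    by (intro has_integral_mult_right has_integral_of_real)
  then have "((\<lambda>x. weight Y k0 \<alpha> x * monomial Y k0 \<alpha> n x * monomial Y k0 \<alpha> m x)
      has_integral C * of_real (\<bar>k0\<bar> * k0 ^ (n + m) * c)) {0<..}"
    by (rule has_integral_eq[rotated]) (simp only: weight_mult greaterThan_iff)
  moreover have "C * of_real (\<bar>k0\<bar> * k0 ^ (n + m) * c) = C * of_real (norm_factor k0 \<alpha> n) * of_bool (m = n)"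
    by (auto simp: c_def norm_factor_def mult_2)
  ultimately show ?thesis
    unfolding has_integral_atLeast_eq_greaterThan by (simp only:)
qed

lemma norm_factor_pos: "norm_factor k0 \<alpha> n > 0"
proof -
  have "k0 ^ (2 * n) > 0"
    using k0_nonzero by (simp add: power_mult)
  then show ?thesis
    unfolding norm_factor_def using k0_nonzero alpha_gt gbinomial_add_self_pos[OF alpha_gt, of n]
    by (intro divide_pos_pos mult_pos_pos Gamma_real_pos) auto
qed

lemma normalized_monomial_orthogonal:
  "((\<lambda>x. weight Y k0 \<alpha> x
       * (monomial Y k0 \<alpha> n x / of_real (sqrt (norm_factor k0 \<alpha> n)))
       * (monomial Y k0 \<alpha> m x / of_real (sqrt (norm_factor k0 \<alpha> m))))
     has_integral C * of_bool (m = n)) {0..}"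
proof -
  let ?s = "\<lambda>n. complex_of_real (sqrt (norm_factor k0 \<alpha> n))"
  have "((\<lambda>x. weight Y k0 \<alpha> x * monomial Y k0 \<alpha> n x * monomial Y k0 \<alpha> m x / (?s n * ?s m))
     has_integral C * of_real (norm_factor k0 \<alpha> n) * of_bool (m = n) / (?s n * ?s m)) {0..}"
    by (rule has_integral_divide[OF monomial_orthogonal])
  moreover have "C * of_real (norm_factor k0 \<alpha> n) * of_bool (m = n) / (?s n * ?s m) = C * of_bool (m = n)"
    using norm_factor_pos[of n] by (auto simp flip: of_real_mult)
  ultimately show ?thesis
    by (simp add: mult_ac)
qed

end

text \<open>The three forms agree only up to nonzero constants, so each is shown to solve the
  problem, the ratios are given, and the bare constant in the orthogonality relation appears after
  normalization. Integrability of the monomials is asserted because \<open>integral\<close> defaults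
  to 0 otherwise.\<close>

theorem theorem4:
  fixes Y :: "real \<Rightarrow> real" and k0 \<alpha> :: real
  assumes "Y 0 = 0"
    and "continuous_on {0..} Y"
    and "\<And>i x. i < 3 \<Longrightarrow> 0 < x \<Longrightarrow> (deriv ^^ i) Y differentiable (at x)"
    and "\<And>x. 0 < x \<Longrightarrow> deriv Y x \<noteq> 0"
    and "filterlim (\<lambda>x. Y x / k0) at_bot at_top"
    and "\<alpha> > -1"
  shows
    "(\<forall>n. (\<forall>x>0. monomial Y k0 \<alpha> n integrable_on {0..x})
        \<and> solves_eigenproblem Y k0 \<alpha> (real n + 1) (monomial Y k0 \<alpha> n)
        \<and> solves_eigenproblem Y k0 \<alpha> (real n + 1) (sum_form Y k0 \<alpha> n)
        \<and> solves_eigenproblem Y k0 \<alpha> (real n + 1) (laguerre_form Y k0 \<alpha> n))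
   \<and> (\<forall>n. ((real n + \<alpha>) gchoose n) \<noteq> 0 \<and> (\<forall>x>0.
        monomial Y k0 \<alpha> n x = of_real (1 / ((real n + \<alpha>) gchoose n)) * sum_form Y k0 \<alpha> n x
      \<and> sum_form Y k0 \<alpha> n x = of_real (k0 ^ n) * laguerre_form Y k0 \<alpha> n x))
   \<and> (\<forall>n m. ((\<lambda>x. weight Y k0 \<alpha> x * monomial Y k0 \<alpha> n x * monomial Y k0 \<alpha> m x)
        has_integral of_real (- k0) powr of_real \<alpha> * of_real (norm_factor k0 \<alpha> n) * of_bool (m = n)) {0..})
   \<and> (\<forall>n. 0 < norm_factor k0 \<alpha> n)
   \<and> (\<forall>n m. ((\<lambda>x. weight Y k0 \<alpha> x
                 * (monomial Y k0 \<alpha> n x / of_real (sqrt (norm_factor k0 \<alpha> n)))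
                 * (monomial Y k0 \<alpha> m x / of_real (sqrt (norm_factor k0 \<alpha> m))))
        has_integral of_real (- k0) powr of_real \<alpha> * of_bool (m = n)) {0..})"
proof -
  interpret laguerre_gauge Y k0 \<alpha>
    using assms by unfold_locales
  have binomial_nonzero: "((real n + \<alpha>) gchoose n) \<noteq> 0" for n
    using gbinomial_add_self_pos[OF alpha_gt, of n] by simp
  have sum_form_eq: "sum_form Y k0 \<alpha> n x = C * of_real (k0 ^ n * ((real n + \<alpha>) gchoose n)) *
      of_real (deriv Y x * pow_poly \<alpha> (scaled_laguerre \<alpha> n) (z x))" if "x > 0" for n x
    unfolding sum_form_eq_laguerre_form laguerre_form_eq[OF that] by simp
  show ?thesis
  proof (intro conjI allI impI)
    show "monomial Y k0 \<alpha> n integrable_on {0..x}" if "x > 0" for n x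
      using has_integral_mode[OF monomial_eq that] by blast
    show "monomial Y k0 \<alpha> n x = of_real (1 / ((real n + \<alpha>) gchoose n)) * sum_form Y k0 \<alpha> n x"
      if "x > 0" for n x
      using that binomial_nonzero[of n] by (simp add: monomial_eq sum_form_eq)
  qed (use binomial_nonzero sum_form_eq_laguerre_form monomial_orthogonal norm_factor_pos
        normalized_monomial_orthogonal in \<open>auto simp only: C_def
          intro: solves_eigenproblemI[OF monomial_eq] solves_eigenproblemI[OF sum_form_eq]
            solves_eigenproblemI[OF laguerre_form_eq]\<close>)
qed

end
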